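(* Let $\overline{I}=\{I,+,-,\times,<,0,1\}$ be the integer structure. For any integer $j\neq 0$, let $\overline{I}^{j}$ and $\overline{I}_{j}$ be the external and internal representations of the structure scaled by $j$. Then $\overline{I}_{j}$ satisfies the integer axioms if and only if $\overline{I}^{j}$ does if and only if $\overline{I}$ does.
   Context: The integer axioms are the axioms of an ordered integral domain, in the language $\{+,-,\times,<,0,1\}$. Elements of $I$ are identified with their values in $\overline{I}$. Let $I_{j}=\{ja: a\in I\}$ be the set of elements of $I$ whose values in $\overline{I}$ are (positive, negative or zero) multiples of $j$; in particular $I_{-1}=I$. External representation: for $j>0$, $\overline{I}^{j}=\{I_{j},+,-,\frac{\times}{j},<,0,j\}$, where $+,-,<$ are those of $\overline{I}$ restricted to $I_{j}$, multiplication is $(ja)\,\frac{\times}{j}\,(jb):=\frac{(ja)\times(jb)}{j}=j(a\times b)$, the additive identity is $0$ and the multiplicative identity is $j$. For $j<0$, $\overline{I}^{j}=\{I_{j},+,-,\frac{\times}{j},>,0,j\}$, defined in the same way except that the relation playing the role of "less than" in $\overline{I}^{j}$ is the relation $>$ of $\overline{I}$ (so $x$ is less than $y$ in $\overline{I}^{j}$ if and only if $x>y$ in $\overline{I}$). Internal representation: $\overline{I}_{j}=\{I_{j},+_{j},-_{j},\times_{j},<_{j},0_{j},1_{j}\}$ is the same structure with values renamed: the element whose value in $\overline{I}$ is $ja$ has value denoted $a_{j}$ in $\overline{I}_{j}$, and the operations, the order relation and the constants are those of $\overline{I}^{j}$ transported along this renaming. *)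

theory Defs
  imports "HOL-Algebra.Ring"
begin

record 'a ordered_ring_struct = "'a ring" +
  sub :: "'a \<Rightarrow> 'a \<Rightarrow> 'a"
  lt :: "'a \<Rightarrow> 'a \<Rightarrow> bool"

definition integer_axioms :: "('a, 'm) ordered_ring_struct_scheme \<Rightarrow> bool" where
  "integer_axioms S \<longleftrightarrow>
     domain S
   \<and> (\<forall>x \<in> carrier S. \<forall>y \<in> carrier S. sub S x y = x \<ominus>\<^bsub>S\<^esub> y)
   \<and> (\<forall>x \<in> carrier S. \<not> lt S x x)
   \<and> (\<forall>x \<in> carrier S. \<forall>y \<in> carrier S. \<forall>z \<in> carrier S. lt S x y \<longrightarrow> lt S y z \<longrightarrow> lt S x z)
   \<and> (\<forall>x \<in> carrier S. \<forall>y \<in> carrier S. lt S x y \<or> x = y \<or> lt S y x)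
   \<and> (\<forall>x \<in> carrier S. \<forall>y \<in> carrier S. \<forall>z \<in> carrier S.
        lt S x y \<longrightarrow> lt S (x \<oplus>\<^bsub>S\<^esub> z) (y \<oplus>\<^bsub>S\<^esub> z))
   \<and> (\<forall>x \<in> carrier S. \<forall>y \<in> carrier S.
        lt S \<zero>\<^bsub>S\<^esub> x \<longrightarrow> lt S \<zero>\<^bsub>S\<^esub> y \<longrightarrow> lt S \<zero>\<^bsub>S\<^esub> (x \<otimes>\<^bsub>S\<^esub> y))"

definition integer_structure :: "int ordered_ring_struct" where
  "integer_structure =
     \<lparr>carrier = UNIV, mult = (*), one = 1, zero = 0, add = (+), sub = (-), lt = (<)\<rparr>"

definition scaled_set :: "int \<Rightarrow> int set" where
  "scaled_set j = {j * a | a. a \<in> carrier integer_structure}"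

text \<open>The division by \<open>j\<close> is exact on \<open>scaled_set j\<close>, see \<open>external_rep_mult\<close> below.\<close>

definition external_rep :: "int \<Rightarrow> int ordered_ring_struct" where
  "external_rep j =
     \<lparr>carrier = scaled_set j, mult = (\<lambda>x y. (x * y) div j), one = j, zero = 0,
      add = (+), sub = (-), lt = (if j > 0 then (\<lambda>x y. x < y) else (\<lambda>x y. x > y))\<rparr>"

text \<open>\<open>Val j a\<close> is the value written \<open>a\<close> with subscript \<open>j\<close>. Values for different scale
  factors are distinct, and none of them is an integer.\<close>

datatype scaled_value = Val int int

text \<open>\<open>rename j\<close> is meant for arguments in \<open>scaled_set j\<close>, where it sends \<open>j * a\<close>
  to \<open>Val j a\<close>.\<close>

definition rename :: "int \<Rightarrow> int \<Rightarrow> scaled_value" where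
  "rename j x = Val j (x div j)"

definition transport ::
    "('a \<Rightarrow> 'b) \<Rightarrow> 'a ordered_ring_struct \<Rightarrow> 'b ordered_ring_struct" where
  "transport f S = (let g = inv_into (carrier S) f in
     \<lparr>carrier = f ` carrier S,
      mult = (\<lambda>x y. f (g x \<otimes>\<^bsub>S\<^esub> g y)),
      one = f \<one>\<^bsub>S\<^esub>,
      zero = f \<zero>\<^bsub>S\<^esub>,
      add = (\<lambda>x y. f (g x \<oplus>\<^bsub>S\<^esub> g y)),
      sub = (\<lambda>x y. f (sub S (g x) (g y))),
      lt = (\<lambda>x y. lt S (g x) (g y))\<rparr>)"

definition internal_rep :: "int \<Rightarrow> scaled_value ordered_ring_struct" where
  "internal_rep j = transport (rename j) (external_rep j)"

lemma external_rep_mult: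
  "j \<noteq> 0 \<Longrightarrow> (j * a) \<otimes>\<^bsub>external_rep j\<^esub> (j * b) = j * (a * b)"
  by (simp add: external_rep_def mult.assoc mult.left_commute)

lemma rename_multiple: "j \<noteq> 0 \<Longrightarrow> rename j (j * a) = Val j a"
  by (simp add: rename_def)

lemma bij_betw_rename:
  "j \<noteq> 0 \<Longrightarrow> bij_betw (rename j) (carrier (external_rep j)) (range (Val j))"
  by (rule bij_betw_byWitness[where f' = "\<lambda>v. case v of Val _ a \<Rightarrow> j * a"])
    (auto simp: external_rep_def scaled_set_def integer_structure_def rename_def)

end

theory Submission
  imports Defs "HOL-Algebra.QuotRing"
begin

text \<open>
  The three structures are copies of one another: \<open>a \<mapsto> j * a\<close> is an isomorphism from the
  integers onto the external representation, and renaming is by construction an isomorphism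
  from there onto the internal one. Satisfaction of the integer axioms is invariant under
  isomorphism, so no axiom has to be examined in any particular structure. The one place
  where the scaled structure looks different is its order: multiplication by a negative \<open>j\<close>
  reverses \<open><\<close> on the integers, which is exactly why the external representation reads \<open>>\<close> as
  its order in that case.
\<close>

text \<open>
  A structure record carries total functions on the ambient type, so closure of the carrier
  of \<open>S\<close> has to be part of the notion of isomorphism: without it the homomorphism equations
  would not pass to the inverse map, and the relation would not be symmetric.
\<close>

definition structure_iso ::
    "('a \<Rightarrow> 'b) \<Rightarrow> ('a, 'm) ordered_ring_struct_scheme \<Rightarrow>
      ('b, 'n) ordered_ring_struct_scheme \<Rightarrow> bool" where
  "structure_iso f S T \<longleftrightarrow>
     bij_betw f (carrier S) (carrier T)
   \<and> \<zero>\<^bsub>S\<^esub> \<in> carrier S \<and> f \<zero>\<^bsub>S\<^esub> = \<zero>\<^bsub>T\<^esub>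
   \<and> \<one>\<^bsub>S\<^esub> \<in> carrier S \<and> f \<one>\<^bsub>S\<^esub> = \<one>\<^bsub>T\<^esub>
   \<and> (\<forall>x \<in> carrier S. \<forall>y \<in> carrier S.
        x \<oplus>\<^bsub>S\<^esub> y \<in> carrier S \<and> f (x \<oplus>\<^bsub>S\<^esub> y) = f x \<oplus>\<^bsub>T\<^esub> f y
      \<and> x \<otimes>\<^bsub>S\<^esub> y \<in> carrier S \<and> f (x \<otimes>\<^bsub>S\<^esub> y) = f x \<otimes>\<^bsub>T\<^esub> f y
      \<and> sub S x y \<in> carrier S \<and> f (sub S x y) = sub T (f x) (f y)
      \<and> lt S x y = lt T (f x) (f y))"

lemma structure_iso_inv_into:
  assumes "structure_iso f S T"
  shows "structure_iso (inv_into (carrier S) f) T S"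
proof -
  have bij: "bij_betw f (carrier S) (carrier T)"
    using assms by (simp add: structure_iso_def)
  then have T: "carrier T = f ` carrier S" and inj: "inj_on f (carrier S)"
    by (auto simp: bij_betw_def)
  have inv: "inv_into (carrier S) f (f x) = x" if "x \<in> carrier S" for x
    using inj that by simp
  have ops: "f x \<oplus>\<^bsub>T\<^esub> f y = f (x \<oplus>\<^bsub>S\<^esub> y)" "x \<oplus>\<^bsub>S\<^esub> y \<in> carrier S"
    "f x \<otimes>\<^bsub>T\<^esub> f y = f (x \<otimes>\<^bsub>S\<^esub> y)" "x \<otimes>\<^bsub>S\<^esub> y \<in> carrier S"
    "sub T (f x) (f y) = f (sub S x y)" "sub S x y \<in> carrier S"
    "lt T (f x) (f y) = lt S x y"
    if "x \<in> carrier S" "y \<in> carrier S" for x y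
    using assms that by (auto simp: structure_iso_def)
  have constants: "\<zero>\<^bsub>T\<^esub> = f \<zero>\<^bsub>S\<^esub>" "\<zero>\<^bsub>S\<^esub> \<in> carrier S" "\<one>\<^bsub>T\<^esub> = f \<one>\<^bsub>S\<^esub>" "\<one>\<^bsub>S\<^esub> \<in> carrier S"
    using assms by (auto simp: structure_iso_def)
  show ?thesis
    using bij_betw_inv_into[OF bij]
    unfolding structure_iso_def T by (simp add: inv ops constants)
qed

lemma integer_axioms_structure_iso:
  assumes iso: "structure_iso f S T" and S: "integer_axioms S"
  shows "integer_axioms T"
proof -
  interpret S: domain S
    using S by (simp add: integer_axioms_def)
  have T: "carrier T = f ` carrier S"
    using iso by (auto simp: structure_iso_def bij_betw_def)
  have zero: "f \<zero>\<^bsub>S\<^esub> = \<zero>\<^bsub>T\<^esub>"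
    using iso by (simp add: structure_iso_def)
  have ring_iso: "f \<in> ring_iso S T"
    using iso by (auto simp: structure_iso_def ring_iso_def ring_hom_def bij_betw_def)
  have "T\<lparr>zero := f \<zero>\<^bsub>S\<^esub>\<rparr> = T"
    by (simp add: zero)
  then have T_domain: "domain T"
    using S.ring_iso_imp_img_domain[OF ring_iso] by (simp only:)
  interpret T: domain T by (rule T_domain)
  interpret f: ring_hom_cring S T f
    using ring_iso by unfold_locales (simp add: ring_iso_def)
  have minus: "f x \<ominus>\<^bsub>T\<^esub> f y = f (x \<ominus>\<^bsub>S\<^esub> y)" if "x \<in> carrier S" "y \<in> carrier S" for x y
    using that by (simp add: a_minus_def)
  have sub: "sub T (f x) (f y) = f (sub S x y)"
    and lt: "lt T (f x) (f y) = lt S x y"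
    if "x \<in> carrier S" "y \<in> carrier S" for x y
    using iso that by (auto simp: structure_iso_def)
  have lt_zero: "lt T \<zero>\<^bsub>T\<^esub> (f x) = lt S \<zero>\<^bsub>S\<^esub> x" if "x \<in> carrier S" for x
    using lt[of "\<zero>\<^bsub>S\<^esub>" x] that by (simp add: zero)
  have add: "f x \<oplus>\<^bsub>T\<^esub> f y = f (x \<oplus>\<^bsub>S\<^esub> y)" and mult: "f x \<otimes>\<^bsub>T\<^esub> f y = f (x \<otimes>\<^bsub>S\<^esub> y)"
    if "x \<in> carrier S" "y \<in> carrier S" for x y
    using that by simp_all
  \<comment> \<open>Every element of \<open>T\<close> is an image, so each axiom about \<open>T\<close> pulls back to one about \<open>S\<close>.\<close>
  show ?thesis
    unfolding integer_axioms_def T ball_simps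
  proof (intro conjI ballI impI)
    show "domain T"
      by (rule T_domain)
  next
    fix x y assume "x \<in> carrier S" "y \<in> carrier S"
    then show "sub T (f x) (f y) = f x \<ominus>\<^bsub>T\<^esub> f y"
      using S by (simp add: integer_axioms_def sub minus)
  next
    fix x assume "x \<in> carrier S"
    then show "\<not> lt T (f x) (f x)"
      using S by (simp add: integer_axioms_def lt)
  next
    fix x y z assume "x \<in> carrier S" "y \<in> carrier S" "z \<in> carrier S"
      and "lt T (f x) (f y)" "lt T (f y) (f z)"
    then show "lt T (f x) (f z)"
      using S unfolding integer_axioms_def by (metis lt)
  next
    fix x y assume "x \<in> carrier S" "y \<in> carrier S"
    then show "lt T (f x) (f y) \<or> f x = f y \<or> lt T (f y) (f x)"
      using S unfolding integer_axioms_def by (metis lt)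
  next
    fix x y z assume "x \<in> carrier S" "y \<in> carrier S" "z \<in> carrier S" "lt T (f x) (f y)"
    then show "lt T (f x \<oplus>\<^bsub>T\<^esub> f z) (f y \<oplus>\<^bsub>T\<^esub> f z)"
      using S unfolding integer_axioms_def by (metis lt add S.add.m_closed)
  next
    fix x y assume "x \<in> carrier S" "y \<in> carrier S"
      and "lt T \<zero>\<^bsub>T\<^esub> (f x)" "lt T \<zero>\<^bsub>T\<^esub> (f y)"
    then show "lt T \<zero>\<^bsub>T\<^esub> (f x \<otimes>\<^bsub>T\<^esub> f y)"
      using S unfolding integer_axioms_def by (metis lt_zero mult S.m_closed)
  qed
qed

corollary integer_axioms_structure_iso_iff:
  assumes "structure_iso f S T"
  shows "integer_axioms S \<longleftrightarrow> integer_axioms T"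
  using assms integer_axioms_structure_iso structure_iso_inv_into by metis

lemma structure_iso_external_rep:
  assumes "j \<noteq> 0"
  shows "structure_iso (\<lambda>a. j * a) integer_structure (external_rep j)"
proof -
  have "bij_betw (\<lambda>a. j * a) UNIV (scaled_set j)"
    using assms by (auto simp: bij_betw_def inj_on_def scaled_set_def integer_structure_def)
  then show ?thesis
    using assms external_rep_mult[OF assms]
    by (auto simp: structure_iso_def integer_structure_def external_rep_def
        distrib_left right_diff_distrib mult_less_cancel_left)
qed

text \<open>
  Transport needs \<open>S\<close> to be closed under its operations. The isomorphism \<open>h\<close> serves only to
  supply this: its inverse starts at \<open>S\<close>, and closure of the source belongs to isomorphism.
\<close>

lemma structure_iso_transport:
  assumes iso: "structure_iso h R S" and inj: "inj_on f (carrier S)"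
  shows "structure_iso f S (transport f S)"
  using structure_iso_inv_into[OF iso] inj
  by (auto simp: structure_iso_def transport_def Let_def bij_betw_def)

theorem theorem4:
  fixes j :: int
  assumes "j \<noteq> 0"
  shows "(integer_axioms (internal_rep j) \<longleftrightarrow> integer_axioms (external_rep j))
    \<and> (integer_axioms (external_rep j) \<longleftrightarrow> integer_axioms integer_structure)"
proof -
  note external = structure_iso_external_rep[OF assms]
  have "inj_on (rename j) (carrier (external_rep j))"
    using bij_betw_rename[OF assms] by (rule bij_betw_imp_inj_on)
  then have "structure_iso (rename j) (external_rep j) (internal_rep j)"
    unfolding internal_rep_def by (rule structure_iso_transport[OF external])
  with external show ?thesis
    by (simp add: integer_axioms_structure_iso_iff)
qed

end
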